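(* Let $\mathbb{F}$ be an algebraically closed field of characteristic different from $2$. Every 2-local 1-automorphism of $H_3(\mathcal{O}(\mathbb{F}))$ is an automorphism.
   Context: $\mathcal{Q}(\mathbb{F})$ is a quaternion algebra (basis $\mathbf{1},i,j,k$, $i^2=\lambda\mathbf{1}$, $j^2=\mu\mathbf{1}$, $ij=-ji=k$, $\lambda,\mu\ne0$, involution negating $i,j,k$ coordinates). $\mathcal{O}(\mathbb{F})=\mathcal{Q}(\mathbb{F})\oplus\mathcal{Q}(\mathbb{F})$ with product $(a,b)(c,d)=(ac+\nu\bar db,\ da+b\bar c)$ for fixed nonzero $\nu\in\mathbb{F}$ and involution $\overline{(a,b)}=(\bar a,-b)$ (octonions). $H_3(\mathcal{O}(\mathbb{F}))$ is the Jordan algebra of $3\times3$ matrices $x$ over $\mathcal{O}(\mathbb{F})$ with $x_{ij}=\overline{x_{ji}}$, product $x\circ y=\frac12(xy+yx)$. A symmetry is $s$ with $s\circ s=1$, $U_s(x)=2s\circ(s\circ x)-x$. A 2-local 1-automorphism is a map $\Delta$ (not assumed linear) such that for every $x,y$ there is a symmetry $s$ with $\Delta(x)=U_s(x)$, $\Delta(y)=U_s(y)$. *)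

theory Defs
  imports "HOL-Computational_Algebra.Polynomial"
begin

definition alg_closed_field :: "'a::field itself \<Rightarrow> bool" where
  "alg_closed_field _ \<longleftrightarrow> (\<forall>p::'a poly. degree p > 0 \<longrightarrow> (\<exists>x. poly p x = 0))"

section \<open>Quaternion algebra Q(F) with i^2 = lam, j^2 = mu, ij = -ji = k\<close>

datatype 'a quat = Quat 'a 'a 'a 'a

fun qadd :: "'a::field quat \<Rightarrow> 'a quat \<Rightarrow> 'a quat" where
  "qadd (Quat a0 a1 a2 a3) (Quat b0 b1 b2 b3) = Quat (a0+b0) (a1+b1) (a2+b2) (a3+b3)"

fun qscale :: "'a::field \<Rightarrow> 'a quat \<Rightarrow> 'a quat" where
  "qscale c (Quat a0 a1 a2 a3) = Quat (c*a0) (c*a1) (c*a2) (c*a3)"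

definition qzero :: "'a::field quat" where "qzero = Quat 0 0 0 0"
definition qone :: "'a::field quat" where "qone = Quat 1 0 0 0"

fun qconj :: "'a::field quat \<Rightarrow> 'a quat" where
  "qconj (Quat a0 a1 a2 a3) = Quat a0 (-a1) (-a2) (-a3)"

text \<open>Multiplication table: i^2 = lam, j^2 = mu, k^2 = -lam*mu, ij = k = -ji,
  ik = lam j = -ki, jk = -mu i = -kj.\<close>
fun qmul :: "'a::field \<Rightarrow> 'a \<Rightarrow> 'a quat \<Rightarrow> 'a quat \<Rightarrow> 'a quat" where
  "qmul lam mu (Quat a0 a1 a2 a3) (Quat b0 b1 b2 b3) =
     Quat (a0*b0 + lam*a1*b1 + mu*a2*b2 - lam*mu*a3*b3)
          (a0*b1 + a1*b0 - mu*a2*b3 + mu*a3*b2)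
          (a0*b2 + a2*b0 + lam*a1*b3 - lam*a3*b1)
          (a0*b3 + a3*b0 + a1*b2 - a2*b1)"

section \<open>Octonions O(F) = Q(F) + Q(F) (Cayley--Dickson with parameter nu)\<close>

type_synonym 'a oct = "'a quat \<times> 'a quat"

definition oadd :: "'a::field oct \<Rightarrow> 'a oct \<Rightarrow> 'a oct" where
  "oadd x y = (qadd (fst x) (fst y), qadd (snd x) (snd y))"

definition oscale :: "'a::field \<Rightarrow> 'a oct \<Rightarrow> 'a oct" where
  "oscale c x = (qscale c (fst x), qscale c (snd x))"

definition ozero :: "'a::field oct" where "ozero = (qzero, qzero)"
definition oone :: "'a::field oct" where "oone = (qone, qzero)"

definition oconj :: "'a::field oct \<Rightarrow> 'a oct" where
  "oconj x = (qconj (fst x), qscale (-1) (snd x))"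

definition omul :: "'a::field \<Rightarrow> 'a \<Rightarrow> 'a \<Rightarrow> 'a oct \<Rightarrow> 'a oct \<Rightarrow> 'a oct" where
  "omul lam mu nu x y =
     (let a = fst x; b = snd x; c = fst y; d = snd y in
       (qadd (qmul lam mu a c) (qscale nu (qmul lam mu (qconj d) b)),
        qadd (qmul lam mu d a) (qmul lam mu b (qconj c))))"

text \<open>3x3 matrices are functions nat => nat => oct, indices in {0,1,2},
  entries outside that range are zero.\<close>
type_synonym 'a mat3 = "nat \<Rightarrow> nat \<Rightarrow> 'a oct"

definition H3 :: "'a::field mat3 set" where
  "H3 = {x. (\<forall>i j. (i \<ge> 3 \<or> j \<ge> 3) \<longrightarrow> x i j = ozero) \<and>
            (\<forall>i<3. \<forall>j<3. x i j = oconj (x j i))}"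

definition madd :: "'a::field mat3 \<Rightarrow> 'a mat3 \<Rightarrow> 'a mat3" where
  "madd x y = (\<lambda>i j. oadd (x i j) (y i j))"

definition mscale :: "'a::field \<Rightarrow> 'a mat3 \<Rightarrow> 'a mat3" where
  "mscale c x = (\<lambda>i j. oscale c (x i j))"

definition mone :: "'a::field mat3" where
  "mone = (\<lambda>i j. if i < 3 \<and> i = j then oone else ozero)"

definition mmul :: "'a::field \<Rightarrow> 'a \<Rightarrow> 'a \<Rightarrow> 'a mat3 \<Rightarrow> 'a mat3 \<Rightarrow> 'a mat3" where
  "mmul lam mu nu x y = (\<lambda>i j.
     oadd (oadd (omul lam mu nu (x i 0) (y 0 j)) (omul lam mu nu (x i 1) (y 1 j)))
          (omul lam mu nu (x i 2) (y 2 j)))"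

definition jprod :: "'a::field \<Rightarrow> 'a \<Rightarrow> 'a \<Rightarrow> 'a mat3 \<Rightarrow> 'a mat3 \<Rightarrow> 'a mat3" where
  "jprod lam mu nu x y = mscale (inverse 2) (madd (mmul lam mu nu x y) (mmul lam mu nu y x))"

definition is_symmetry :: "'a::field \<Rightarrow> 'a \<Rightarrow> 'a \<Rightarrow> 'a mat3 \<Rightarrow> bool" where
  "is_symmetry lam mu nu s \<longleftrightarrow> s \<in> H3 \<and> jprod lam mu nu s s = mone"

definition Uop :: "'a::field \<Rightarrow> 'a \<Rightarrow> 'a \<Rightarrow> 'a mat3 \<Rightarrow> 'a mat3 \<Rightarrow> 'a mat3" where
  "Uop lam mu nu s x =
     madd (mscale 2 (jprod lam mu nu s (jprod lam mu nu s x))) (mscale (-1) x)"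

definition two_local_1_automorphism ::
  "'a::field \<Rightarrow> 'a \<Rightarrow> 'a \<Rightarrow> ('a mat3 \<Rightarrow> 'a mat3) \<Rightarrow> bool" where
  "two_local_1_automorphism lam mu nu D \<longleftrightarrow>
     (\<forall>x\<in>H3. \<forall>y\<in>H3. \<exists>s. is_symmetry lam mu nu s \<and>
        D x = Uop lam mu nu s x \<and> D y = Uop lam mu nu s y)"

definition jordan_automorphism ::
  "'a::field \<Rightarrow> 'a \<Rightarrow> 'a \<Rightarrow> ('a mat3 \<Rightarrow> 'a mat3) \<Rightarrow> bool" where
  "jordan_automorphism lam mu nu D \<longleftrightarrow>
     bij_betw D H3 H3 \<and>
     (\<forall>x\<in>H3. \<forall>y\<in>H3. D (madd x y) = madd (D x) (D y)) \<and>
     (\<forall>c. \<forall>x\<in>H3. D (mscale c x) = mscale c (D x)) \<and>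
     (\<forall>x\<in>H3. \<forall>y\<in>H3. D (jprod lam mu nu x y) = jprod lam mu nu (D x) (D y))"

end

theory Submission
  imports Defs "HOL-Library.Product_Plus"
begin

text \<open>
  For a symmetry \<open>s\<close> of a Jordan algebra the Peirce decomposition shows that \<open>U\<^sub>s\<close> is an
  automorphism, and it is self-adjoint with respect to an associative form. Hence a 2-local
  1-automorphism \<open>D\<close> preserves the trace form of \<open>H\<^sub>3(\<O>)\<close>. That form is nondegenerate on a
  finite-dimensional space, so the image of a basis spans, which forces \<open>D\<close> to be linear. Locality
  at the pair \<open>x, x\<^sup>2\<close> gives \<open>D (x\<^sup>2) = (D x)\<^sup>2\<close>, and linearizing this yields multiplicativity.

  The Jordan identity in \<open>H\<^sub>3(\<O>)\<close> is derived from the composition law of the octonion norm alone: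
  the alternative and Moufang identities are obtained by pairing both sides with an arbitrary
  octonion, and cyclic symmetry of the three coordinates reduces the Jordan identity to two cases.
\<close>

section \<open>Jordan algebras with an associative form\<close>

text \<open>A finite orthogonal spanning set of nonisotropic vectors encodes both finite dimension
  and nondegeneracy of \<open>form\<close>, in a shape that can be checked on explicit
  vectors.\<close>

locale jordan_form = vector_space scale
  for scale :: "'a::field \<Rightarrow> 'v::ab_group_add \<Rightarrow> 'v" +
  fixes mul :: "'v \<Rightarrow> 'v \<Rightarrow> 'v" (infixl "\<bullet>" 70)
    and one :: 'v
    and form :: "'v \<Rightarrow> 'v \<Rightarrow> 'a"
    and Basis :: "'v set"
  assumes two_nonzero: "(2::'a) \<noteq> 0"
    and mul_commute: "x \<bullet> y = y \<bullet> x"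
    and mul_add_left: "(x + y) \<bullet> z = x \<bullet> z + y \<bullet> z"
    and mul_scale_left: "scale r x \<bullet> z = scale r (x \<bullet> z)"
    and one_mul: "one \<bullet> x = x"
    and jordan: "((x \<bullet> x) \<bullet> y) \<bullet> x = (x \<bullet> x) \<bullet> (y \<bullet> x)"
    and form_commute: "form x y = form y x"
    and form_add_left: "form (x + y) z = form x z + form y z"
    and form_scale_left: "form (scale r x) z = r * form x z"
    and form_assoc: "form (x \<bullet> y) z = form x (y \<bullet> z)"
    and finite_Basis: "finite Basis"
    and span_Basis: "span Basis = UNIV"
    and Basis_orthogonal: "\<lbrakk>x \<in> Basis; y \<in> Basis; x \<noteq> y\<rbrakk> \<Longrightarrow> form x y = 0"
    and Basis_nonisotropic: "x \<in> Basis \<Longrightarrow> form x x \<noteq> 0"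
begin

section \<open>Bilinearity and nondegeneracy\<close>

lemma mul_add_right: "z \<bullet> (x + y) = z \<bullet> x + z \<bullet> y"
  by (simp add: mul_commute[of z] mul_add_left)

lemma mul_scale_right: "z \<bullet> scale r x = scale r (z \<bullet> x)"
  by (simp add: mul_commute[of z] mul_scale_left)

lemma mul_zero_left [simp]: "0 \<bullet> x = 0"
  using mul_scale_left[of 0 0 x] by simp

lemma mul_zero_right [simp]: "x \<bullet> 0 = 0"
  using mul_commute[of x 0] by simp

lemma mul_minus_left: "(- x) \<bullet> z = - (x \<bullet> z)"
  using mul_scale_left[of "-1" x z] by simp

lemma mul_diff_left: "(x - y) \<bullet> z = x \<bullet> z - y \<bullet> z"
  using mul_add_left[of x "- y" z] by (simp add: mul_minus_left)

lemma mul_diff_right: "z \<bullet> (x - y) = z \<bullet> x - z \<bullet> y"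
  by (simp add: mul_commute[of z] mul_diff_left)

lemmas mul_linear = mul_add_left mul_add_right mul_diff_left mul_diff_right
  mul_scale_left mul_scale_right

lemma form_minus_left: "form (- x) z = - form x z"
  using form_scale_left[of "-1" x z] by simp

lemma form_diff_left: "form (x - y) z = form x z - form y z"
  using form_add_left[of x "- y" z] by (simp add: form_minus_left)

lemma form_zero_left [simp]: "form 0 z = 0"
  using form_scale_left[of 0 0 z] by simp

lemma form_diff_right: "form z (x - y) = form z x - form z y"
  by (simp add: form_commute[of z] form_diff_left)

lemma form_scale_right: "form z (scale r x) = r * form z x"
  by (simp add: form_commute[of z] form_scale_left)

lemma form_sum_left: "form (sum f A) z = (\<Sum>i\<in>A. form (f i) z)"
  by (induction A rule: infinite_finite_induct) (simp_all add: form_add_left)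

lemma scale_two: "scale 2 x = x + x"
  using scale_left_distrib[of 1 1 x] by simp

lemma double_eq_0: "(x::'v) + x = 0 \<Longrightarrow> x = 0"
  using two_nonzero scale_two[of x] by simp

lemma form_nondegenerate:
  assumes "\<And>z. form x z = 0"
  shows "x = 0"
proof -
  from span_Basis have "x \<in> span Basis"
    by simp
  then obtain r where x: "x = (\<Sum>a\<in>Basis. scale (r a) a)"
    using finite_Basis by (auto simp: span_finite)
  have "r a = 0" if "a \<in> Basis" for a
  proof -
    have "0 = form x a"
      using assms by simp
    also have "\<dots> = (\<Sum>b\<in>Basis. r b * form b a)"
      by (simp add: x form_sum_left form_scale_left)
    also have "\<dots> = (\<Sum>b\<in>Basis. if b = a then r a * form a a else 0)"
      by (rule sum.cong) (auto simp: Basis_orthogonal that)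
    finally show ?thesis
      using that finite_Basis Basis_nonisotropic by simp
  qed
  then show ?thesis
    by (simp add: x)
qed

section \<open>Linearized Jordan identity and Peirce decomposition of a symmetry\<close>

lemma jordan_linearized:
  "((x \<bullet> z) \<bullet> y) \<bullet> w + ((z \<bullet> w) \<bullet> y) \<bullet> x + ((w \<bullet> x) \<bullet> y) \<bullet> z =
   (x \<bullet> z) \<bullet> (y \<bullet> w) + (z \<bullet> w) \<bullet> (y \<bullet> x) + (w \<bullet> x) \<bullet> (y \<bullet> z)"
proof -
  define T where "T a b c = ((a \<bullet> b) \<bullet> y) \<bullet> c - (a \<bullet> b) \<bullet> (y \<bullet> c)" for a b c
  have T_add: "T (a + a') b c = T a b c + T a' b c" "T a (b + b') c = T a b c + T a b' c"
      "T a b (c + c') = T a b c + T a b c'" for a a' b b' c c'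
    by (simp_all add: T_def mul_linear)
  have T_sym: "T a b c = T b a c" for a b c
    by (simp add: T_def mul_commute)
  have T_diag: "T a a a = 0" for a
    by (simp add: T_def jordan)
  let ?S = "T x z w + T z w x + T w x z"
  \<comment> \<open>Inclusion-exclusion keeps the six terms in which \<open>x\<close>,
    \<open>z\<close>, \<open>w\<close> each occur once; symmetry of \<open>T\<close> in its first
    two arguments pairs them. Only a factor 2 has to be cancelled, so characteristic 3 is
    covered.\<close>
  have "?S + ?S = T (x + z + w) (x + z + w) (x + z + w) - T (x + z) (x + z) (x + z)
      - T (x + w) (x + w) (x + w) - T (z + w) (z + w) (z + w) + T x x x + T z z z + T w w w"
    unfolding T_add by (simp add: T_sym[of z x] T_sym[of w z] T_sym[of x w])
  then have "?S + ?S = 0"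
    unfolding T_diag by simp
  then have "?S = 0"
    by (rule double_eq_0)
  then show ?thesis
    by (simp add: T_def algebra_simps)
qed

text \<open>The quadratic operator 2 L_s^2 - L_(s^2), specialised to
  \<open>s \<bullet> s = one\<close>. Here L_s denotes multiplication by \<open>s\<close>.\<close>

definition U :: "'v \<Rightarrow> 'v \<Rightarrow> 'v" where
  "U s x = scale 2 (s \<bullet> (s \<bullet> x)) - x"

lemma U_add: "U s (x + y) = U s x + U s y"
  by (simp add: U_def mul_linear scale_right_distrib)

lemma U_diff: "U s (x - y) = U s x - U s y"
  by (simp add: U_def mul_linear scale_right_diff_distrib)

lemma U_adjoint: "form (U s x) y = form x (U s y)"
proof -
  have "form (s \<bullet> (s \<bullet> x)) y = form x (s \<bullet> (s \<bullet> y))"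
    using form_assoc[of "s \<bullet> x" s y] form_assoc[of x s "s \<bullet> y"]
    by (simp add: mul_commute[of _ s])
  then show ?thesis
    by (simp add: U_def form_diff_left form_diff_right form_scale_left form_scale_right)
qed

context
  fixes s :: 'v
  assumes symmetry: "s \<bullet> s = one"
begin

text \<open>Two of the polarized arguments are \<open>s\<close>: the terms with
  \<open>s \<bullet> s = one\<close> cancel and the other two agree. So L_s commutes with
  multiplication by every \<open>s \<bullet> z\<close>.\<close>

lemma mul_symmetry_commute: "((s \<bullet> z) \<bullet> y) \<bullet> s = (s \<bullet> z) \<bullet> (y \<bullet> s)"
proof -
  let ?d = "((s \<bullet> z) \<bullet> y) \<bullet> s - (s \<bullet> z) \<bullet> (y \<bullet> s)"
  have "?d + ?d = 0"
    using jordan_linearized[of s s y z]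
    by (simp add: symmetry one_mul mul_commute[of z s] algebra_simps)
  then show ?thesis
    using double_eq_0[of ?d] by simp
qed

text \<open>The choice \<open>y = s\<close> above gives L_s^3 = L_s, so the possible eigenvalues are
  1, -1 and 0.\<close>

lemma mul_symmetry_cube: "s \<bullet> (s \<bullet> (s \<bullet> x)) = s \<bullet> x"
  using mul_symmetry_commute[of x s] by (metis mul_commute one_mul symmetry)

lemma U_fixed: "s \<bullet> (s \<bullet> x) = x \<Longrightarrow> U s x = x"
  by (simp add: U_def scale_two)

lemma U_negated: "s \<bullet> x = 0 \<Longrightarrow> U s x = - x"
  by (simp add: U_def)

text \<open>L_s^2 is a projection because L_s^3 = L_s. The eigenspaces for 1 and -1 stay merged,
  since \<open>U s\<close> involves L_s only through L_s^2.\<close>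

lemma peirce_decomposition:
  obtains x1 x0 where "x = x1 + x0" "s \<bullet> (s \<bullet> x1) = x1" "s \<bullet> x0 = 0"
proof
  show "x = s \<bullet> (s \<bullet> x) + (x - s \<bullet> (s \<bullet> x))"
    by simp
  show "s \<bullet> (s \<bullet> (s \<bullet> (s \<bullet> x))) = s \<bullet> (s \<bullet> x)"
    by (simp add: mul_symmetry_cube)
  show "s \<bullet> (x - s \<bullet> (s \<bullet> x)) = 0"
    by (simp add: mul_diff_right mul_symmetry_cube)
qed

text \<open>Because \<open>x\<close> has the form \<open>s \<bullet> z\<close>, multiplication by
  \<open>x\<close> commutes with L_s, so L_s can be moved past \<open>x\<close> twice.\<close>

lemma peirce_mul_11:
  assumes "s \<bullet> (s \<bullet> x) = x" "s \<bullet> (s \<bullet> y) = y"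
  shows "s \<bullet> (s \<bullet> (x \<bullet> y)) = x \<bullet> y"
proof -
  have *: "s \<bullet> (x \<bullet> z) = x \<bullet> (s \<bullet> z)" for z
    using mul_symmetry_commute[of "s \<bullet> x" z] by (simp add: assms mul_commute[of _ s])
  show ?thesis
    by (simp add: * assms)
qed

lemma peirce_mul_10:
  assumes "s \<bullet> (s \<bullet> x) = x" "s \<bullet> y = 0"
  shows "s \<bullet> (x \<bullet> y) = 0"
  using mul_symmetry_commute[of "s \<bullet> x" y] by (simp add: assms mul_commute[of _ s])

text \<open>In the linearized identity at \<open>s, x, s, y\<close> every term containing
  \<open>s \<bullet> x\<close> or \<open>s \<bullet> y\<close> vanishes; one term survives on each
  side.\<close>

lemma peirce_mul_00:
  assumes "s \<bullet> x = 0" "s \<bullet> y = 0"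
  shows "s \<bullet> (s \<bullet> (x \<bullet> y)) = x \<bullet> y"
  using jordan_linearized[of s x s y]
  by (simp add: assms symmetry one_mul mul_commute[of "x \<bullet> y"] mul_commute[of "s \<bullet> (x \<bullet> y)"] mul_commute[of y s])

text \<open>By the three product rules the Peirce parts form a grading by Z/2, with the image of
  L_s^2 even and the kernel of L_s odd. \<open>U s\<close> is the sign involution of this
  grading.\<close>

lemma U_mul: "U s (x \<bullet> y) = U s x \<bullet> U s y"
proof -
  obtain x1 x0 where x: "x = x1 + x0" "s \<bullet> (s \<bullet> x1) = x1" "s \<bullet> x0 = 0"
    by (rule peirce_decomposition)
  obtain y1 y0 where y: "y = y1 + y0" "s \<bullet> (s \<bullet> y1) = y1" "s \<bullet> y0 = 0"
    by (rule peirce_decomposition)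
  have "U s (x0 \<bullet> y1) = - (x0 \<bullet> y1)"
    using peirce_mul_10[OF y(2) x(3)] U_negated by (simp add: mul_commute)
  then have "U s (x \<bullet> y) = x1 \<bullet> y1 - x1 \<bullet> y0 - x0 \<bullet> y1 + x0 \<bullet> y0"
    unfolding x(1) y(1) mul_linear U_add
    using x y by (simp add: U_fixed U_negated peirce_mul_11 peirce_mul_10 peirce_mul_00)
  also have "\<dots> = (x1 - x0) \<bullet> (y1 - y0)"
    by (simp add: mul_linear)
  also have "\<dots> = U s x \<bullet> U s y"
    unfolding x(1) y(1) U_add using x y by (simp add: U_fixed U_negated)
  finally show ?thesis .
qed

text \<open>\<open>U s\<close> is both self-adjoint and an involution.\<close>

lemma U_isometry: "form (U s x) (U s y) = form x y"
proof -
  have "U s (U s y) = y"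
    by (rule peirce_decomposition[of y])
      (simp add: U_add U_diff U_fixed U_negated)
  then show ?thesis
    by (simp add: U_adjoint)
qed

end

section \<open>Isometries and two-local maps\<close>

lemma form_eqI: "(\<And>z. form x z = form y z) \<Longrightarrow> x = y"
  using form_nondegenerate[of "x - y"] by (simp add: form_diff_left)

text \<open>A dimension count from preserved form values, before \<open>D\<close> is known to be
  linear: a nonzero vector orthogonal to the image of \<open>Basis\<close> would enlarge it to an
  independent set with more than \<open>card Basis\<close> elements.\<close>

lemma isometry_image_Basis_spans:
  assumes iso: "\<And>x y. form (D x) (D y) = form x y"
  shows "span (D ` Basis) = UNIV"
proof -
  have inj: "inj D"
    by (rule injI, rule form_eqI) (metis iso)
  let ?C = "D ` Basis"
  have orth: "form c d = 0" if "c \<in> ?C" "d \<in> ?C" "c \<noteq> d" for c d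
    using that by (force simp: iso intro!: Basis_orthogonal)
  have noniso: "form c c \<noteq> 0" if "c \<in> ?C" for c
    using that by (auto simp: iso Basis_nonisotropic)
  have fin: "finite ?C"
    using finite_Basis by simp
  have "v \<in> span ?C" for v
  proof -
    \<comment> \<open>What remains of \<open>v\<close> after orthogonal projection to the span of
      \<open>?C\<close>.\<close>
    define w where "w = v - (\<Sum>c\<in>?C. scale (form v c / form c c) c)"
    have w_orth: "form w d = 0" if "d \<in> ?C" for d
    proof -
      have "(\<Sum>c\<in>?C. form v c / form c c * form c d) = (\<Sum>c\<in>?C. if c = d then form v d else 0)"
        by (rule sum.cong) (use orth noniso that in auto)
      also have "\<dots> = form v d"
        using that fin by simp
      finally show ?thesis
        by (simp add: w_def form_diff_left form_sum_left form_scale_left)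
    qed
    have "w = 0"
    proof (rule ccontr)
      assume "w \<noteq> 0"
      have w_notin: "w \<notin> ?C"
        using w_orth noniso by blast
      have indep: "r b = 0" if sum0: "(\<Sum>a\<in>insert w ?C. scale (r a) a) = 0" and "b \<in> insert w ?C" for r b
      proof -
        have *: "scale (r w) w + (\<Sum>a\<in>?C. scale (r a) a) = 0"
          using sum0 fin w_notin by simp
        \<comment> \<open>Pairing with \<open>d\<close> isolates \<open>r d\<close>. As
          \<open>w\<close> may be isotropic, its own coefficient is settled afterwards from
          \<open>w \<noteq> 0\<close> instead.\<close>
        have r0: "r d = 0" if "d \<in> ?C" for d
        proof -
          have "0 = form (scale (r w) w + (\<Sum>a\<in>?C. scale (r a) a)) d"
            by (simp add: *)
          also have "\<dots> = (\<Sum>c\<in>?C. r c * form c d)"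
            by (simp add: form_add_left form_sum_left form_scale_left w_orth that)
          also have "\<dots> = (\<Sum>c\<in>?C. if c = d then r d * form d d else 0)"
            by (rule sum.cong) (use orth that in auto)
          finally show ?thesis
            using that fin noniso by simp
        qed
        with * have "r w = 0"
          using \<open>w \<noteq> 0\<close> by simp
        with r0 that(2) show ?thesis
          by blast
      qed
      have "independent (insert w ?C)"
        by (rule independent_if_scalars_zero) (use fin indep in blast)+
      then have "card (insert w ?C) \<le> card Basis"
        using independent_span_bound[OF finite_Basis, of "insert w ?C"] span_Basis by simp
      moreover have "card ?C = card Basis"
        using inj by (simp add: card_image inj_on_subset)
      ultimately show False
        using fin w_notin by simp
    qed
    then have "v = (\<Sum>c\<in>?C. scale (form v c / form c c) c)"
      by (simp add: w_def)
    then show ?thesis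
      by (metis (no_types, lifting) span_sum span_scale span_base)
  qed
  then show ?thesis
    by blast
qed

theorem two_local_automorphism:
  assumes "\<And>x y. \<exists>s. s \<bullet> s = one \<and> D x = U s x \<and> D y = U s y"
  shows "bij D" "D (x + y) = D x + D y" "D (scale r x) = scale r (D x)"
    "D (x \<bullet> y) = D x \<bullet> D y"
proof -
  have iso: "form (D x) (D y) = form x y" for x y
    using assms[of x y] U_isometry by auto
  have square: "D (x \<bullet> x) = D x \<bullet> D x" for x
    using assms[of x "x \<bullet> x"] U_mul by auto
  \<comment> \<open>Since the vectors \<open>D z\<close> span, an equation can be tested on them;
    there \<open>iso\<close> removes \<open>D\<close>, which yields additivity and
    homogeneity.\<close>
  have eqI: "u = v" if eq: "\<And>z. form u (D z) = form v (D z)" for u v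
  proof (rule form_eqI)
    fix z
    have "z \<in> span (D ` Basis)"
      using isometry_image_Basis_spans[of D] iso by simp
    then show "form u z = form v z"
      by (induction rule: span_induct_alt)
        (auto simp: form_commute[of u] form_commute[of v] form_add_left form_scale_left
          eq[unfolded form_commute[of u] form_commute[of v]])
  qed
  have add: "D (x + y) = D x + D y" for x y
    by (rule eqI) (simp add: form_add_left iso)
  have scl: "D (scale r x) = scale r (D x)" for x r
    by (rule eqI) (simp add: form_scale_left iso)
  show "D (x + y) = D x + D y" "D (scale r x) = scale r (D x)"
    by (fact add scl)+
  \<comment> \<open>Expanding the square rule at \<open>x + y\<close> leaves the mixed
    terms.\<close>
  have "D (x \<bullet> y) + D (x \<bullet> y) = D x \<bullet> D y + D x \<bullet> D y"
    using square[of "x + y"] by (simp add: add mul_linear square mul_commute algebra_simps)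
  then have "(D (x \<bullet> y) - D x \<bullet> D y) + (D (x \<bullet> y) - D x \<bullet> D y) = 0"
    by (simp add: algebra_simps)
  then show "D (x \<bullet> y) = D x \<bullet> D y"
    using double_eq_0[of "D (x \<bullet> y) - D x \<bullet> D y"] by simp
  have "inj D"
    by (rule injI, rule form_eqI) (metis iso)
  \<comment> \<open>The range of \<open>D\<close> is by now a subspace, and it contains a spanning
    set.\<close>
  moreover have "v \<in> range D" for v
  proof -
    have "v \<in> span (D ` Basis)"
      using isometry_image_Basis_spans[of D] iso by simp
    then show ?thesis
    proof (induction rule: span_induct_alt)
      case base
      have "D 0 = 0"
        using scl[of 0 0] by simp
      then show ?case
        by (metis rangeI)
    next
      case (step c u w)
      then show ?case
        by (auto simp flip: add scl)
    qed
  qed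
  ultimately show "bij D"
    by (auto simp: bij_def)
qed

end

section \<open>Composition algebras\<close>

text \<open>\<open>ip\<close> is the polar form of the norm, so the norm of \<open>x\<close> is \<open>ip x x / 2\<close>; this is where the
  factor 2 in the composition law comes from.\<close>

locale composition_algebra = vector_space scale
  for scale :: "'a::field \<Rightarrow> 'o::ab_group_add \<Rightarrow> 'o" (infixr "*s" 75) +
  fixes mul :: "'o \<Rightarrow> 'o \<Rightarrow> 'o" (infixl "\<cdot>" 70)
    and one :: 'o
    and ip :: "'o \<Rightarrow> 'o \<Rightarrow> 'a"
  assumes two_nonzero: "(2::'a) \<noteq> 0"
    and mul_add_left: "(x + y) \<cdot> z = x \<cdot> z + y \<cdot> z"
    and mul_add_right: "z \<cdot> (x + y) = z \<cdot> x + z \<cdot> y"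
    and mul_scale_left: "(r *s x) \<cdot> z = r *s (x \<cdot> z)"
    and mul_scale_right: "z \<cdot> (r *s x) = r *s (z \<cdot> x)"
    and one_mul [simp]: "one \<cdot> x = x"
    and mul_one [simp]: "x \<cdot> one = x"
    and ip_commute: "ip x y = ip y x"
    and ip_add_left: "ip (x + y) z = ip x z + ip y z"
    and ip_scale_left: "ip (r *s x) z = r * ip x z"
    and ip_nondegenerate: "(\<And>z. ip x z = 0) \<Longrightarrow> x = 0"
    and ip_one_one: "ip one one = 2"
    and composition: "2 * ip (x \<cdot> y) (x \<cdot> y) = ip x x * ip y y"
begin

lemma mul_minus_left: "(- x) \<cdot> z = - (x \<cdot> z)"
  using mul_scale_left[of "-1" x z] by simp

lemma mul_minus_right: "z \<cdot> (- x) = - (z \<cdot> x)"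
  using mul_scale_right[of z "-1" x] by simp

lemma mul_diff_left: "(x - y) \<cdot> z = x \<cdot> z - y \<cdot> z"
  using mul_add_left[of x "- y" z] by (simp add: mul_minus_left)

lemma mul_diff_right: "z \<cdot> (x - y) = z \<cdot> x - z \<cdot> y"
  using mul_add_right[of z x "- y"] by (simp add: mul_minus_right)

lemma mul_zero [simp]: "0 \<cdot> x = 0" "x \<cdot> 0 = 0"
  using mul_scale_left[of 0 0 x] mul_scale_right[of x 0 0] by simp_all

lemma ip_add_right: "ip z (x + y) = ip z x + ip z y"
  by (simp add: ip_commute[of z] ip_add_left)

lemma ip_scale_right: "ip z (r *s x) = r * ip z x"
  by (simp add: ip_commute[of z] ip_scale_left)

lemma ip_minus_left: "ip (- x) z = - ip x z"
  using ip_scale_left[of "-1" x z] by simp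

lemma ip_diff_left: "ip (x - y) z = ip x z - ip y z"
  using ip_add_left[of x "- y" z] by (simp add: ip_minus_left)

lemma ip_diff_right: "ip z (x - y) = ip z x - ip z y"
  by (simp add: ip_commute[of z] ip_diff_left)

lemma ip_zero [simp]: "ip 0 z = 0" "ip z 0 = 0"
  using ip_scale_left[of 0 0 z] ip_scale_right[of z 0 0] by simp_all

lemmas ip_linear = ip_add_left ip_add_right ip_diff_left ip_diff_right ip_scale_left ip_scale_right

lemmas mul_linear = mul_add_left mul_add_right mul_diff_left mul_diff_right
  mul_scale_left mul_scale_right

lemma ip_eqI: "(\<And>z. ip x z = ip y z) \<Longrightarrow> x = y"
  using ip_nondegenerate[of "x - y"] by (simp add: ip_diff_left)

section \<open>Polarized composition law, conjugation and adjoints\<close>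

lemma ip_mul_mul: "ip (x \<cdot> y) (w \<cdot> z) + ip (w \<cdot> y) (x \<cdot> z) = ip x w * ip y z"
proof -
  \<comment> \<open>Polarization in the right factor; the left factor follows below.\<close>
  have partial: "2 * ip (x \<cdot> y) (x \<cdot> z) = ip x x * ip y z" for x y z
  proof -
    have "2 * (2 * ip (x \<cdot> y) (x \<cdot> z)) = 2 * (ip x x * ip y z)"
      using composition[of x "y + z"] composition[of x y] composition[of x z]
        ip_commute[of "x \<cdot> z" "x \<cdot> y"] ip_commute[of z y]
      by (simp add: mul_linear ip_linear algebra_simps)
    then show ?thesis
      using two_nonzero by (simp only: mult_cancel_left) simp
  qed
  have "2 * (ip (x \<cdot> y) (w \<cdot> z) + ip (w \<cdot> y) (x \<cdot> z)) = 2 * (ip x w * ip y z)"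
    using partial[of "x + w" y z] partial[of x y z] partial[of w y z] ip_commute[of w x]
    by (simp add: mul_linear ip_linear algebra_simps)
  then show ?thesis
    using two_nonzero by (simp only: mult_cancel_left) simp
qed

text \<open>The reflection that fixes \<open>one\<close> and negates its orthogonal complement, as
  \<open>ip one one = 2\<close>. Defined through the form, it obeys rules that all come from the
  composition law.\<close>

definition cj :: "'o \<Rightarrow> 'o" where
  "cj x = ip x one *s one - x"

definition N :: "'o \<Rightarrow> 'a" where
  "N x = ip x x / 2"

lemma ip_self: "ip x x = 2 * N x"
  using two_nonzero by (simp add: N_def)

lemma cj_add: "cj (x + y) = cj x + cj y"
  by (simp add: cj_def ip_linear scale_left_distrib)

lemma cj_diff: "cj (x - y) = cj x - cj y"
  by (simp add: cj_def ip_linear scale_left_diff_distrib)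

lemma cj_scale: "cj (r *s x) = r *s cj x"
  by (simp add: cj_def ip_linear scale_right_diff_distrib)

lemma cj_zero [simp]: "cj 0 = 0"
  by (simp add: cj_def)

lemma ip_cj_one: "ip (cj x) one = ip x one"
  by (simp add: cj_def ip_linear ip_one_one)

lemma cj_cj [simp]: "cj (cj x) = x"
  by (simp add: ip_cj_one cj_def[of "cj x"]) (simp add: cj_def)

lemma ip_cj_left: "ip (cj x) y = ip x (cj y)"
  by (simp add: cj_def ip_linear ip_commute[of one])

lemma ip_cj_cj [simp]: "ip (cj x) (cj y) = ip x y"
  by (simp add: ip_cj_left)

lemma N_cj [simp]: "N (cj x) = N x"
  by (simp add: N_def)

text \<open>With \<open>one\<close> as one of the left factors, the exchange law
  \<open>ip_mul_mul\<close> says that the adjoint of left multiplication by \<open>x\<close> is left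
  multiplication by \<open>cj x\<close>.\<close>

lemma ip_mul_left: "ip (x \<cdot> y) z = ip y (cj x \<cdot> z)"
  using ip_mul_mul[of x y one z] by (simp add: cj_def mul_linear ip_linear algebra_simps)

lemma ip_mul_right: "ip (x \<cdot> y) z = ip x (z \<cdot> cj y)"
  using ip_mul_mul[of x y z one] ip_commute[of "z \<cdot> y" x]
  by (simp add: cj_def mul_linear ip_linear algebra_simps)

lemma cj_mul: "cj (x \<cdot> y) = cj y \<cdot> cj x"
proof (rule ip_eqI)
  fix z
  have "ip (cj (x \<cdot> y)) z = ip x (cj z \<cdot> cj y)"
    by (simp add: ip_cj_left ip_mul_right)
  also have "\<dots> = ip (cj y) (z \<cdot> x)"
    by (simp add: ip_commute[of x] ip_mul_left)
  also have "\<dots> = ip (cj y \<cdot> cj x) z"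
    by (simp add: ip_mul_right)
  finally show "ip (cj (x \<cdot> y)) z = ip (cj y \<cdot> cj x) z" .
qed

section \<open>Alternative and Moufang identities\<close>

lemma left_alternative_linearized: "x \<cdot> (cj w \<cdot> y) + w \<cdot> (cj x \<cdot> y) = ip x w *s y"
proof (rule ip_eqI)
  fix z
  \<comment> \<open>Once the outer factors are moved across the form, this is the exchange law for
    \<open>cj w\<close> and \<open>cj x\<close>.\<close>
  show "ip (x \<cdot> (cj w \<cdot> y) + w \<cdot> (cj x \<cdot> y)) z = ip (ip x w *s y) z"
    using ip_mul_mul[of "cj w" y "cj x" z]
    by (simp add: ip_linear ip_mul_left[of x] ip_mul_left[of w] ip_commute[of w])
qed

lemma right_alternative_linearized: "(y \<cdot> cj w) \<cdot> x + (y \<cdot> cj x) \<cdot> w = ip x w *s y"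
proof (rule ip_eqI)
  fix z
  show "ip ((y \<cdot> cj w) \<cdot> x + (y \<cdot> cj x) \<cdot> w) z = ip (ip x w *s y) z"
    using ip_mul_mul[of y "cj w" z "cj x"]
    by (simp add: ip_linear ip_mul_right[of _ x] ip_mul_right[of _ w] ip_commute[of "z \<cdot> cj w"]
        ip_commute[of w] mult.commute)
qed

lemma halve_scale: "u + u = (2 * r) *s v \<Longrightarrow> u = r *s v"
proof -
  assume "u + u = (2 * r) *s v"
  moreover have "u + u = 2 *s u"
    using scale_left_distrib[of 1 1 u] by simp
  ultimately have "2 *s u = 2 *s (r *s v)"
    by simp
  then show ?thesis
    using two_nonzero by (simp only: scale_cancel_left) simp
qed

lemma left_alternative [simp]: "x \<cdot> (cj x \<cdot> y) = N x *s y" "cj x \<cdot> (x \<cdot> y) = N x *s y"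
proof -
  show *: "x \<cdot> (cj x \<cdot> y) = N x *s y" for x
    using left_alternative_linearized[of x x y] by - (rule halve_scale, simp add: ip_self)
  show "cj x \<cdot> (x \<cdot> y) = N x *s y"
    using *[of "cj x"] by simp
qed

lemma right_alternative [simp]: "(y \<cdot> cj x) \<cdot> x = N x *s y" "(y \<cdot> x) \<cdot> cj x = N x *s y"
proof -
  show *: "(y \<cdot> cj x) \<cdot> x = N x *s y" for x
    using right_alternative_linearized[of y x x] by - (rule halve_scale, simp add: ip_self)
  show "(y \<cdot> x) \<cdot> cj x = N x *s y"
    using *[of "cj x"] by simp
qed

text \<open>The middle Moufang identity polarized in the outer variable: with u = b c, the right
  side is the polarization in \<open>a\<close> of a u a = ip a (cj u) a - N(a) cj u.\<close>

lemma moufang_linearized: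
  "(p \<cdot> b) \<cdot> (c \<cdot> a) + (a \<cdot> b) \<cdot> (c \<cdot> p) =
   ip p (cj (b \<cdot> c)) *s a + ip a (cj (b \<cdot> c)) *s p - ip a p *s cj (b \<cdot> c)"
proof (rule ip_eqI)
  fix z
  \<comment> \<open>The exchange law leaves a single word in
    \<open>p \<cdot> (cj a \<cdot> cj c)\<close>. Adding the version with \<open>p\<close> and
    \<open>a\<close> interchanged lets the left alternative law absorb it.\<close>
  have *: "ip ((p \<cdot> b) \<cdot> (c \<cdot> a)) z = ip p z * ip a (cj (b \<cdot> c)) - ip (p \<cdot> (cj a \<cdot> cj c)) (z \<cdot> b)"
    for p a
  proof -
    have "ip ((p \<cdot> b) \<cdot> (c \<cdot> a)) z = ip (p \<cdot> b) (z \<cdot> (cj a \<cdot> cj c))"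
      by (simp add: ip_mul_right[of "p \<cdot> b"] cj_mul)
    also have "\<dots> = ip p z * ip b (cj a \<cdot> cj c) - ip (z \<cdot> b) (p \<cdot> (cj a \<cdot> cj c))"
      using ip_mul_mul[of p b z "cj a \<cdot> cj c"] by (simp add: algebra_simps)
    also have "ip b (cj a \<cdot> cj c) = ip a (cj (b \<cdot> c))"
      by (simp add: ip_commute[of b] ip_mul_right[of "cj a"] ip_cj_left[of a] cj_mul)
    finally show ?thesis
      by (simp add: ip_commute)
  qed
  have "ip (p \<cdot> (cj a \<cdot> cj c)) (z \<cdot> b) + ip (a \<cdot> (cj p \<cdot> cj c)) (z \<cdot> b) = ip a p * ip (cj c) (z \<cdot> b)"
    using left_alternative_linearized[of p a "cj c"]
    by (simp add: ip_commute[of a p] flip: ip_add_left ip_scale_left)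
  moreover have "ip (cj c) (z \<cdot> b) = ip (cj (b \<cdot> c)) z"
    by (simp add: cj_mul ip_mul_right)
  ultimately show "ip ((p \<cdot> b) \<cdot> (c \<cdot> a) + (a \<cdot> b) \<cdot> (c \<cdot> p)) z =
      ip (ip p (cj (b \<cdot> c)) *s a + ip a (cj (b \<cdot> c)) *s p - ip a p *s cj (b \<cdot> c)) z"
    using *[of p a] *[of a p] unfolding ip_linear by algebra
qed

lemma moufang:
  "(b \<cdot> p) \<cdot> (c \<cdot> b) = ip b (cj (p \<cdot> c)) *s b - N b *s cj (p \<cdot> c)"
proof -
  have "(b \<cdot> p) \<cdot> (c \<cdot> b) + (b \<cdot> p) \<cdot> (c \<cdot> b) =
      2 *s (ip b (cj (p \<cdot> c)) *s b - N b *s cj (p \<cdot> c))"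
    unfolding moufang_linearized
    by (rule ip_eqI) (simp add: ip_linear ip_self algebra_simps)
  then have "(b \<cdot> p) \<cdot> (c \<cdot> b) = 1 *s (ip b (cj (p \<cdot> c)) *s b - N b *s cj (p \<cdot> c))"
    by - (rule halve_scale, simp)
  then show ?thesis
    by simp
qed

text \<open>Needed for the off-diagonal case of the Jordan identity. Paired with \<open>z\<close>,
  both words become pairings with \<open>cj c\<close> in which \<open>a\<close> and \<open>z\<close>
  have changed places, so their sum reduces by the left alternative law.\<close>

lemma moufang_companion:
  "(p \<cdot> (cj a \<cdot> cj c)) \<cdot> cj b + cj c \<cdot> ((cj b \<cdot> cj a) \<cdot> p) =
   ip a p *s (cj c \<cdot> cj b) - ip (cj c \<cdot> cj b) p *s a + ip a (cj c \<cdot> cj b) *s p"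
proof (rule ip_eqI)
  fix z
  have 1: "ip ((p \<cdot> (cj a \<cdot> cj c)) \<cdot> cj b) z = ip (cj c) (a \<cdot> (cj p \<cdot> (z \<cdot> b)))"
    by (simp add: ip_mul_right[of _ "cj b"] ip_mul_left[of p] ip_mul_left[of "cj a"])
  have 2: "ip (cj c \<cdot> ((cj b \<cdot> cj a) \<cdot> p)) z = ip (cj c) (z \<cdot> (cj p \<cdot> (a \<cdot> b)))"
    by (simp add: ip_mul_right[of "cj c"] cj_mul)
  have 3: "cj p \<cdot> (x \<cdot> b) = ip p x *s b - cj x \<cdot> (p \<cdot> b)" for x
    using left_alternative_linearized[of "cj p" "cj x" b] by (simp add: algebra_simps)
  have 4: "a \<cdot> (cj p \<cdot> (z \<cdot> b)) + z \<cdot> (cj p \<cdot> (a \<cdot> b)) =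
      ip p z *s (a \<cdot> b) + ip p a *s (z \<cdot> b) - ip a z *s (p \<cdot> b)"
    using left_alternative_linearized[of a z "p \<cdot> b"]
    by (simp add: 3 mul_linear algebra_simps)
  have 5: "ip (cj c) (x \<cdot> b) = ip (cj c \<cdot> cj b) x" for x
    by (simp add: ip_mul_right)
  show "ip ((p \<cdot> (cj a \<cdot> cj c)) \<cdot> cj b + cj c \<cdot> ((cj b \<cdot> cj a) \<cdot> p)) z =
      ip (ip a p *s (cj c \<cdot> cj b) - ip (cj c \<cdot> cj b) p *s a + ip a (cj c \<cdot> cj b) *s p) z"
    using arg_cong[OF 4, of "ip (cj c)"]
    by (simp add: ip_linear 1 2 5 ip_commute[of p a] ip_commute[of a "cj c \<cdot> cj b"] ip_commute[of a z] algebra_simps)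
qed

end

section \<open>Hermitian 3 by 3 matrices over a composition algebra\<close>

text \<open>The tuple \<open>(r, s, t, a, b, c)\<close> stands for the hermitian matrix with diagonal \<open>r, s, t\<close> and
  entries \<open>a, b, c\<close> at positions 23, 31, 12 (counted from 1). With these positions all formulas are
  invariant under \<open>rotate\<close>. The bracket \<open>brace x y\<close> is \<open>xy + yx\<close>, without the factor 1/2.\<close>

type_synonym ('a, 'o) herm = "'a \<times> 'a \<times> 'a \<times> 'o \<times> 'o \<times> 'o"

context composition_algebra
begin

fun brace :: "('a, 'o) herm \<Rightarrow> ('a, 'o) herm \<Rightarrow> ('a, 'o) herm" where
  "brace (r, s, t, a, b, c) (r', s', t', a', b', c') =
    (2 * r * r' + ip b b' + ip c c',
     2 * s * s' + ip c c' + ip a a',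
     2 * t * t' + ip a a' + ip b b',
     (s + t) *s a' + (s' + t') *s a + cj (b \<cdot> c' + b' \<cdot> c),
     (t + r) *s b' + (t' + r') *s b + cj (c \<cdot> a' + c' \<cdot> a),
     (r + s) *s c' + (r' + s') *s c + cj (a \<cdot> b' + a' \<cdot> b))"

fun hscale :: "'a \<Rightarrow> ('a, 'o) herm \<Rightarrow> ('a, 'o) herm" where
  "hscale k (r, s, t, a, b, c) = (k * r, k * s, k * t, k *s a, k *s b, k *s c)"

text \<open>The trace form: half the sum of the diagonal entries of \<open>brace\<close>.\<close>

fun hform :: "('a, 'o) herm \<Rightarrow> ('a, 'o) herm \<Rightarrow> 'a" where
  "hform (r, s, t, a, b, c) (r', s', t', a', b', c') =
    r * r' + s * s' + t * t' + ip a a' + ip b b' + ip c c'"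

fun square :: "('a, 'o) herm \<Rightarrow> ('a, 'o) herm" where
  "square (r, s, t, a, b, c) =
    (r * r + N b + N c, s * s + N c + N a, t * t + N a + N b,
     (s + t) *s a + cj (b \<cdot> c), (t + r) *s b + cj (c \<cdot> a), (r + s) *s c + cj (a \<cdot> b))"

fun rotate :: "('a, 'o) herm \<Rightarrow> ('a, 'o) herm" where
  "rotate (r, s, t, a, b, c) = (s, t, r, b, c, a)"

section \<open>Cyclic symmetry and bilinearity of the bracket\<close>

lemma brace_rotate: "brace (rotate x) (rotate y) = rotate (brace x y)"
  by (cases x; cases y) simp

lemma square_rotate: "square (rotate x) = rotate (square x)"
  by (cases x) simp

lemmas cj_linear = cj_add cj_diff cj_scale

lemma hscale_vector_space: "vector_space hscale"
  by unfold_locales (auto simp: scale_right_distrib scale_left_distrib algebra_simps)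

text \<open>Pairing the off-diagonal entries with an arbitrary \<open>z\<close> turns vector
  equations into field equations that the simplifier can normalise.\<close>

lemma herm_eqI:
  assumes "r = r'" "s = s'" "t = t'"
    and "\<And>z. ip a z = ip a' z" "\<And>z. ip b z = ip b' z" "\<And>z. ip c z = ip c' z"
  shows "(r, s, t, a, b, c) = (r', s', t', a', b', c')"
  using assms ip_eqI by auto

lemma brace_self: "brace x x = hscale 2 (square x)"
proof (cases x)
  case (fields r s t a b c)
  show ?thesis
    unfolding fields brace.simps square.simps hscale.simps
    by (rule herm_eqI) (simp_all add: ip_self ip_linear cj_linear algebra_simps)
qed

lemma brace_commute: "brace x y = brace y x"
  by (cases x; cases y) (simp add: ip_commute algebra_simps)

lemma brace_add_left: "brace (x + y) z = brace x z + brace y z"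
  by (cases x; cases y; cases z)
    (simp add: ip_linear mul_linear cj_linear scale_right_distrib scale_left_distrib algebra_simps)

lemma brace_add_right: "brace z (x + y) = brace z x + brace z y"
  by (simp add: brace_commute[of z] brace_add_left)

lemma brace_scale_left: "brace (hscale k x) z = hscale k (brace x z)"
  by (cases x; cases z)
    (simp add: ip_linear mul_linear cj_linear scale_right_distrib scale_left_distrib algebra_simps)

section \<open>The Jordan identity for hermitian matrices\<close>

lemma brace_square_diagonal:
  "brace (brace (square x) (k, 0, 0, 0, 0, 0)) x = brace (square x) (brace (k, 0, 0, 0, 0, 0) x)"
proof (cases x)
  case (fields r s t a b c)
  \<comment> \<open>For this diagonal argument the longer products collapse by the alternative laws,
    which are simplification rules.\<close>
  show ?thesis
    unfolding fields brace.simps square.simps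
    by (rule herm_eqI) (simp_all add: ip_linear mul_linear cj_linear cj_mul ip_commute algebra_simps)
qed

text \<open>\<open>ip u (cj v \<cdot> cj w)\<close> is the trace of u (w v), which is invariant
  under cyclic shifts.\<close>

lemma ip_cyclic: "ip u (cj v \<cdot> cj w) = ip v (cj w \<cdot> cj u)"
  by (simp add: ip_commute[of u] ip_mul_right[of "cj v"] ip_cj_left[of v] cj_mul)

lemma ip_mul_mul_left: "ip (x \<cdot> y) (x \<cdot> z) = N x * ip y z"
  by (simp add: ip_mul_left ip_linear)

lemma ip_mul_mul_right: "ip (y \<cdot> x) (z \<cdot> x) = N x * ip y z"
  by (simp add: ip_mul_right ip_linear)

lemma brace_square_offdiagonal:
  "brace (brace (square x) (0, 0, 0, p, 0, 0)) x = brace (square x) (brace (0, 0, 0, p, 0, 0) x)"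
proof (cases x)
  case (fields r s t a b c)
  \<comment> \<open>Normal forms for the scalars in the diagonal entries: trilinear traces are
    rotated to start with \<open>p\<close>, and a repeated factor is pulled out as a norm.\<close>
  have ip_words:
    "ip b (cj p \<cdot> cj c) = ip p (cj c \<cdot> cj b)" "ip c (cj b \<cdot> cj p) = ip p (cj c \<cdot> cj b)"
    "ip c (c \<cdot> a \<cdot> cj p) = N c * ip a p" "ip b (cj p \<cdot> (a \<cdot> b)) = N b * ip a p"
    "ip (cj a \<cdot> cj c) (cj p \<cdot> cj c) = N c * ip a p"
    "ip (cj b \<cdot> cj a) (cj b \<cdot> cj p) = N b * ip a p"
    using ip_cyclic[of b p c] ip_cyclic[of c b p] ip_mul_mul_left[of c p a] ip_mul_right[of c p "c \<cdot> a"]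
      ip_mul_mul_right[of p b a] ip_mul_left[of p b "a \<cdot> b"]
    by (simp_all add: ip_mul_mul_left ip_mul_mul_right ip_commute[of p a])
  \<comment> \<open>Each equation expresses a product through shorter ones and at most one partner
    of the same length. The partners serve as normal forms and cancel between the two sides.\<close>
  have words:
    "cj c \<cdot> (cj b \<cdot> cj a \<cdot> p) = ip a p *s (cj c \<cdot> cj b) - ip (cj c \<cdot> cj b) p *s a
      + ip a (cj c \<cdot> cj b) *s p - p \<cdot> (cj a \<cdot> cj c) \<cdot> cj b"
    "a \<cdot> b \<cdot> (c \<cdot> p) = ip p (cj c \<cdot> cj b) *s a + ip a (cj c \<cdot> cj b) *s p
      - ip a p *s (cj c \<cdot> cj b) - p \<cdot> b \<cdot> (c \<cdot> a)"
    "cj a \<cdot> (p \<cdot> b) = ip a p *s b - cj p \<cdot> (a \<cdot> b)"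
    "cj a \<cdot> (p \<cdot> (cj a \<cdot> cj c)) = ip a p *s (cj a \<cdot> cj c) - N a *s (cj p \<cdot> cj c)"
    "b \<cdot> c \<cdot> (p \<cdot> b) = ip b (cj p \<cdot> cj c) *s b - N b *s (cj p \<cdot> cj c)"
    "c \<cdot> p \<cdot> cj a = ip a p *s c - c \<cdot> a \<cdot> cj p"
    "cj b \<cdot> cj a \<cdot> p \<cdot> cj a = ip a p *s (cj b \<cdot> cj a) - N a *s (cj b \<cdot> cj p)"
    "c \<cdot> p \<cdot> (b \<cdot> c) = ip c (cj b \<cdot> cj p) *s c - N c *s (cj b \<cdot> cj p)"
    using moufang_companion[of p a c b] moufang_linearized[of p b c a]
      left_alternative_linearized[of "cj a" "cj p" b]
      left_alternative_linearized[of "cj a" "cj p" "cj a \<cdot> cj c"]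
      moufang[of b c p] right_alternative_linearized[of c "cj a" "cj p"]
      right_alternative_linearized[of "cj b \<cdot> cj a" "cj a" "cj p"] moufang[of c p b]
    by (simp_all add: cj_mul mul_linear ip_commute[of p a] algebra_simps)
  show ?thesis
    unfolding fields brace.simps square.simps
    by (rule herm_eqI)
      (simp_all add: ip_linear mul_linear cj_linear cj_mul ip_commute words ip_words algebra_simps)
qed

lemma rotate_eq_iff: "rotate x = rotate y \<longleftrightarrow> x = y"
  by (cases x; cases y) auto

lemma brace_jordan: "brace (brace (square x) y) x = brace (square x) (brace y x)"
proof -
  \<comment> \<open>\<open>rotate\<close> respects both sides and moves a nonzero coordinate of
    \<open>y\<close> one place left within its triple, cyclically. Hence \<open>d1\<close> and
    \<open>o1\<close> give the other four cases.\<close>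
  have rot: "brace (brace (square x) y) x = brace (square x) (brace y x)"
    if "brace (brace (square (rotate x)) (rotate y)) (rotate x) =
      brace (square (rotate x)) (brace (rotate y) (rotate x))" for x y
    using that by (simp add: square_rotate brace_rotate rotate_eq_iff)
  have d1: "brace (brace (square x) (k, 0, 0, 0, 0, 0)) x = brace (square x) (brace (k, 0, 0, 0, 0, 0) x)" for x k
    by (rule brace_square_diagonal)
  have d2: "brace (brace (square x) (0, k, 0, 0, 0, 0)) x = brace (square x) (brace (0, k, 0, 0, 0, 0) x)" for x k
    by (rule rot) (simp add: d1)
  have d3: "brace (brace (square x) (0, 0, k, 0, 0, 0)) x = brace (square x) (brace (0, 0, k, 0, 0, 0) x)" for x k
    by (rule rot) (simp add: d2)
  have o1: "brace (brace (square x) (0, 0, 0, p, 0, 0)) x = brace (square x) (brace (0, 0, 0, p, 0, 0) x)" for x p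
    by (rule brace_square_offdiagonal)
  have o2: "brace (brace (square x) (0, 0, 0, 0, p, 0)) x = brace (square x) (brace (0, 0, 0, 0, p, 0) x)" for x p
    by (rule rot) (simp add: o1)
  have o3: "brace (brace (square x) (0, 0, 0, 0, 0, p)) x = brace (square x) (brace (0, 0, 0, 0, 0, p) x)" for x p
    by (rule rot) (simp add: o2)
  obtain k l m p q r where "y = (k, l, m, p, q, r)"
    by (cases y)
  then have "y = (k, 0, 0, 0, 0, 0) + (0, l, 0, 0, 0, 0) + (0, 0, m, 0, 0, 0)
      + (0, 0, 0, p, 0, 0) + (0, 0, 0, 0, q, 0) + (0, 0, 0, 0, 0, r)"
    by simp
  then show ?thesis
    by (simp only: brace_add_left brace_add_right d1 d2 d3 o1 o2 o3)
qed

section \<open>The Jordan algebra of hermitian matrices with its trace form\<close>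

lemma brace_scale_right: "brace z (hscale k x) = hscale k (brace z x)"
  by (simp add: brace_commute[of z] brace_scale_left)

definition hmul :: "('a, 'o) herm \<Rightarrow> ('a, 'o) herm \<Rightarrow> ('a, 'o) herm" where
  "hmul x y = hscale (inverse 2) (brace x y)"

definition hone :: "('a, 'o) herm" where
  "hone = (1, 1, 1, 0, 0, 0)"

definition hbasis :: "'o set \<Rightarrow> ('a, 'o) herm set" where
  "hbasis B = {(1, 0, 0, 0, 0, 0), (0, 1, 0, 0, 0, 0), (0, 0, 1, 0, 0, 0)} \<union>
    (\<lambda>e. (0, 0, 0, e, 0, 0)) ` B \<union> (\<lambda>e. (0, 0, 0, 0, e, 0)) ` B \<union> (\<lambda>e. (0, 0, 0, 0, 0, e)) ` B"

lemma half_scale: "inverse 2 * (2 * k) = k" "inverse 2 *s ((2 * k) *s v) = k *s v"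
  using two_nonzero by (simp_all flip: mult.assoc)

text \<open>Terms with a diagonal entry match by bilinearity, and the triple products of
  off-diagonal entries match by cyclicity of their trace.\<close>

lemma hform_brace: "hform (brace x y) z = hform x (brace y z)"
proof (cases x, cases y, cases z)
  fix r s t a b c r' s' t' a' b' c' r'' s'' t'' a'' b'' c''
  assume "x = (r, s, t, a, b, c)" "y = (r', s', t', a', b', c')" "z = (r'', s'', t'', a'', b'', c'')"
  then show ?thesis
    by (simp add: ip_linear cj_linear cj_mul ip_commute algebra_simps
        ip_cyclic[of b] ip_cyclic[of b'] ip_cyclic[of b''] ip_cyclic[of c] ip_cyclic[of c'] ip_cyclic[of c''])
qed

lemma jordan_form_herm:
  assumes "finite B" and span_B: "span B = UNIV"
    and orth: "\<And>x y. x \<in> B \<Longrightarrow> y \<in> B \<Longrightarrow> x \<noteq> y \<Longrightarrow> ip x y = 0"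
    and noniso: "\<And>x. x \<in> B \<Longrightarrow> ip x x \<noteq> 0"
  shows "jordan_form hscale hmul hone hform (hbasis B)"
proof -
  interpret H: vector_space hscale
    by (rule hscale_vector_space)
  show ?thesis
  proof
    show "(2::'a) \<noteq> 0"
      by (rule two_nonzero)
    fix x y z and k :: 'a
    show "hmul x y = hmul y x"
      by (simp add: hmul_def brace_commute)
    show "hmul (x + y) z = hmul x z + hmul y z"
      by (simp add: hmul_def brace_add_left H.scale_right_distrib)
    show "hmul (hscale k x) z = hscale k (hmul x z)"
      by (simp add: hmul_def brace_scale_left mult.commute)
    show "hmul hone x = x"
      using two_nonzero
      by (cases x) (simp add: hmul_def hone_def half_scale)
    show "hmul (hmul (hmul x x) y) x = hmul (hmul x x) (hmul y x)"
      by (simp add: hmul_def brace_self brace_scale_left brace_scale_right brace_jordan)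
    show "hform x y = hform y x"
      by (cases x; cases y) (simp add: ip_commute mult.commute)
    show "hform (x + y) z = hform x z + hform y z"
      by (cases x; cases y; cases z) (simp add: ip_linear algebra_simps)
    show form_scale: "hform (hscale k x) z = k * hform x z" for k x z
      by (cases x; cases z) (simp add: ip_linear algebra_simps)
    have form_scale_right: "hform x (hscale k z) = k * hform x z" for k x z
      by (cases x; cases z) (simp add: ip_linear algebra_simps)
    show "hform (hmul x y) z = hform x (hmul y z)"
      by (simp add: hmul_def form_scale form_scale_right hform_brace)
    show "finite (hbasis B)"
      using assms by (simp add: hbasis_def)
    show "H.span (hbasis B) = UNIV"
    proof -
      have "(0, 0, 0, a, 0, 0) \<in> H.span (hbasis B) \<and> (0, 0, 0, 0, a, 0) \<in> H.span (hbasis B)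
        \<and> (0, 0, 0, 0, 0, a) \<in> H.span (hbasis B)" for a
      proof -
        have "a \<in> span B"
          using span_B by simp
        then show ?thesis
        proof (induction rule: span_induct_alt)
          case base
          then show ?case
            using H.span_zero by (simp add: zero_prod_def)
        next
          case (step k e a)
          have "hscale k (0, 0, 0, e, 0, 0) \<in> H.span (hbasis B)"
            "hscale k (0, 0, 0, 0, e, 0) \<in> H.span (hbasis B)"
            "hscale k (0, 0, 0, 0, 0, e) \<in> H.span (hbasis B)"
            by (intro H.span_scale H.span_base; use step in \<open>simp add: hbasis_def\<close>)+
          with step show ?case
            using H.span_add[of "hscale k (0, 0, 0, e, 0, 0)" _ "(0, 0, 0, a, 0, 0)"]
              H.span_add[of "hscale k (0, 0, 0, 0, e, 0)" _ "(0, 0, 0, 0, a, 0)"]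
              H.span_add[of "hscale k (0, 0, 0, 0, 0, e)" _ "(0, 0, 0, 0, 0, a)"]
            by simp
        qed
      qed
      moreover have "hscale k (1, 0, 0, 0, 0, 0) \<in> H.span (hbasis B)"
          "hscale k (0, 1, 0, 0, 0, 0) \<in> H.span (hbasis B)"
          "hscale k (0, 0, 1, 0, 0, 0) \<in> H.span (hbasis B)" for k
        by (intro H.span_scale H.span_base; simp add: hbasis_def)+
      moreover have "(r, s, t, a, b, c) = hscale r (1, 0, 0, 0, 0, 0) + hscale s (0, 1, 0, 0, 0, 0)
        + hscale t (0, 0, 1, 0, 0, 0) + (0, 0, 0, a, 0, 0) + (0, 0, 0, 0, b, 0) + (0, 0, 0, 0, 0, c)"
        for r s t :: 'a and a b c
        by simp
      ultimately have "(r, s, t, a, b, c) \<in> H.span (hbasis B)" for r s t :: 'a and a b c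
        by (metis H.span_add)
      then show ?thesis
        by auto
    qed
    show "hform x y = 0" if "x \<in> hbasis B" "y \<in> hbasis B" "x \<noteq> y"
      using that by (auto simp: hbasis_def intro: orth)
    show "hform x x \<noteq> 0" if "x \<in> hbasis B"
      using that noniso by (auto simp: hbasis_def)
  qed
qed

end

section \<open>The octonions and their hermitian matrices\<close>

text \<open>With quaternions as an additive group, octonions inherit the group structure as pairs
  and hermitian coordinates as tuples.\<close>

instantiation quat :: (field) ab_group_add
begin

definition "0 = qzero"
definition "x + y = qadd x y"
definition "- x = qscale (-1) x" for x :: "'a quat"
definition "x - y = qadd x (qscale (-1) y)" for x :: "'a quat"

instance
proof
  fix a b c :: "'a quat"
  show "a + b + c = a + (b + c)"
    by (cases a; cases b; cases c) (simp add: plus_quat_def)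
  show "a + b = b + a"
    by (cases a; cases b) (simp add: plus_quat_def)
  show "0 + a = a" "- a + a = 0" "a - b = a + - b"
    by (cases a; cases b; simp add: zero_quat_def plus_quat_def uminus_quat_def minus_quat_def qzero_def)+
qed

end

lemma quat_simps [simp]:
  "Quat a b c d + Quat a' b' c' d' = Quat (a + a') (b + b') (c + c') (d + d')"
  "Quat a b c d - Quat a' b' c' d' = Quat (a - a') (b - b') (c - c') (d - d')"
  "- Quat a b c d = Quat (- a) (- b) (- c) (- d)"
  by (simp_all add: plus_quat_def uminus_quat_def minus_quat_def)

lemma zero_Quat: "0 = Quat 0 0 0 0"
  by (simp add: zero_quat_def qzero_def)

text \<open>The polar form of the norm a0^2 - lam a1^2 - mu a2^2 + lam mu a3^2.\<close>

fun qip :: "'a::field \<Rightarrow> 'a \<Rightarrow> 'a quat \<Rightarrow> 'a quat \<Rightarrow> 'a" where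
  "qip lam mu (Quat a0 a1 a2 a3) (Quat b0 b1 b2 b3) =
    2 * (a0 * b0 - lam * a1 * b1 - mu * a2 * b2 + lam * mu * a3 * b3)"

definition oip :: "'a::field \<Rightarrow> 'a \<Rightarrow> 'a \<Rightarrow> 'a oct \<Rightarrow> 'a oct \<Rightarrow> 'a" where
  "oip lam mu nu x y = qip lam mu (fst x) (fst y) - nu * qip lam mu (snd x) (snd y)"

section \<open>Composition law of the octonion norm\<close>

lemma qip_commute: "qip lam mu x y = qip lam mu y x"
  by (cases x; cases y) (simp add: algebra_simps)

lemma qip_qadd_left: "qip lam mu (qadd x y) z = qip lam mu x z + qip lam mu y z"
  by (cases x; cases y; cases z) (simp add: algebra_simps)

lemma qip_qadd_right: "qip lam mu z (qadd x y) = qip lam mu z x + qip lam mu z y"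
  by (cases x; cases y; cases z) (simp add: algebra_simps)

lemma qip_qscale_left: "qip lam mu (qscale r x) z = r * qip lam mu x z"
  by (cases x; cases z) (simp add: algebra_simps)

lemma qip_qscale_right: "qip lam mu z (qscale r x) = r * qip lam mu z x"
  by (cases x; cases z) (simp add: algebra_simps)

lemma qip_qconj: "qip lam mu (qconj x) (qconj y) = qip lam mu x y"
  by (cases x; cases y) simp

lemma qip_composition:
  "2 * qip lam mu (qmul lam mu x y) (qmul lam mu x y) = qip lam mu x x * qip lam mu y y"
  by (cases x; cases y) (simp add: algebra_simps)

text \<open>Makes the cross terms of the two components of an octonion product cancel in its
  norm.\<close>

lemma qip_qmul_exchange:
  "qip lam mu (qmul lam mu a c) (qmul lam mu (qconj d) b) =
   qip lam mu (qmul lam mu d a) (qmul lam mu b (qconj c))"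
  by (cases a; cases b; cases c; cases d) (simp add: algebra_simps)

lemma oip_composition:
  "2 * oip lam mu nu (omul lam mu nu x y) (omul lam mu nu x y) = oip lam mu nu x x * oip lam mu nu y y"
proof -
  obtain a b c d where xy: "x = (a, b)" "y = (c, d)"
    by (cases x; cases y)
  show ?thesis
    using qip_composition[of lam mu a c] qip_composition[of lam mu "qconj d" b]
      qip_composition[of lam mu d a] qip_composition[of lam mu b "qconj c"]
      qip_qmul_exchange[of lam mu a c d b]
      qip_commute[of lam mu "qmul lam mu (qconj d) b" "qmul lam mu a c"]
      qip_commute[of lam mu "qmul lam mu b (qconj c)" "qmul lam mu d a"]
    unfolding xy oip_def omul_def Let_def fst_conv snd_conv qip_qconj
      qip_qadd_left qip_qadd_right qip_qscale_left qip_qscale_right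
    by algebra
qed

lemma oct_exhaust:
  obtains a0 a1 a2 a3 b0 b1 b2 b3 where "(x::'a oct) = (Quat a0 a1 a2 a3, Quat b0 b1 b2 b3)"
  by (metis surj_pair quat.exhaust)

lemma oadd_eq: "oadd x y = x + y"
  by (simp add: oadd_def plus_prod_def plus_quat_def)

lemma ozero_eq: "ozero = 0"
  by (simp add: ozero_def zero_prod_def zero_quat_def)

definition quat_basis :: "'a::field quat set" where
  "quat_basis = {Quat 1 0 0 0, Quat 0 1 0 0, Quat 0 0 1 0, Quat 0 0 0 1}"

definition oct_basis :: "'a::field oct set" where
  "oct_basis = (\<lambda>q. (q, 0)) ` quat_basis \<union> (\<lambda>q. (0, q)) ` quat_basis"

section \<open>Coordinates for hermitian octonion matrices\<close>

fun herm_matrix :: "('a::field, 'a oct) herm \<Rightarrow> 'a mat3" where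
  "herm_matrix (r, s, t, a, b, c) = (\<lambda>i j.
    if i = 0 \<and> j = 0 then oscale r oone
    else if i = 1 \<and> j = 1 then oscale s oone
    else if i = 2 \<and> j = 2 then oscale t oone
    else if i = 1 \<and> j = 2 then a else if i = 2 \<and> j = 1 then oconj a
    else if i = 2 \<and> j = 0 then b else if i = 0 \<and> j = 2 then oconj b
    else if i = 0 \<and> j = 1 then c else if i = 1 \<and> j = 0 then oconj c
    else 0)"


lemma herm_matrix_entries [simp]:
  "herm_matrix (r, s, t, a, b, c) 0 0 = oscale r oone"
  "herm_matrix (r, s, t, a, b, c) (Suc 0) (Suc 0) = oscale s oone"
  "herm_matrix (r, s, t, a, b, c) 2 2 = oscale t oone"
  "herm_matrix (r, s, t, a, b, c) (Suc 0) 2 = a"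
  "herm_matrix (r, s, t, a, b, c) 2 (Suc 0) = oconj a"
  "herm_matrix (r, s, t, a, b, c) 2 0 = b"
  "herm_matrix (r, s, t, a, b, c) 0 2 = oconj b"
  "herm_matrix (r, s, t, a, b, c) 0 (Suc 0) = c"
  "herm_matrix (r, s, t, a, b, c) (Suc 0) 0 = oconj c"
  by simp_all

lemma herm_matrix_outside: "i \<ge> 3 \<or> j \<ge> 3 \<Longrightarrow> herm_matrix h i j = 0"
  by (induction h rule: herm_matrix.induct) auto

declare herm_matrix.simps [simp del]

lemma less_3_cases: "i < 3 \<longleftrightarrow> i = 0 \<or> i = Suc 0 \<or> i = 2"
  by auto

lemma mat3_eqI:
  assumes "\<And>i j. i \<ge> 3 \<or> j \<ge> 3 \<Longrightarrow> x i j = y i j"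
    and "x 0 0 = y 0 0" "x 0 (Suc 0) = y 0 (Suc 0)" "x 0 2 = y 0 2"
    and "x (Suc 0) 0 = y (Suc 0) 0" "x (Suc 0) (Suc 0) = y (Suc 0) (Suc 0)" "x (Suc 0) 2 = y (Suc 0) 2"
    and "x 2 0 = y 2 0" "x 2 (Suc 0) = y 2 (Suc 0)" "x 2 2 = y 2 2"
  shows "x = y"
proof (intro ext)
  fix i j
  show "x i j = y i j"
  proof (cases "i < 3 \<and> j < 3")
    case True
    then show ?thesis
      using assms unfolding less_3_cases by auto
  next
    case False
    then show ?thesis
      using assms(1) by auto
  qed
qed

lemma oconj_oconj: "oconj (oconj x) = x"
  by (rule oct_exhaust[of x]) (simp add: oconj_def)

lemma oconj_oone: "oconj (oscale k oone) = oscale k oone"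
  by (simp add: oconj_def oscale_def oone_def qone_def qzero_def)

lemma herm_matrix_H3: "herm_matrix h \<in> H3"
proof (induction h rule: herm_matrix.induct)
  case (1 r s t a b c)
  then show ?case
    unfolding H3_def less_3_cases
    by (auto simp: herm_matrix_outside ozero_eq oconj_oconj oconj_oone)
qed

context
  fixes lam mu nu :: "'a::field"
  assumes two_nonzero: "(2::'a) \<noteq> 0" and lam: "lam \<noteq> 0" and mu: "mu \<noteq> 0" and nu: "nu \<noteq> 0"
begin

lemma oct_composition_algebra:
  "composition_algebra oscale (omul lam mu nu) oone (oip lam mu nu)"
proof
  fix x y z :: "'a oct" and r s :: 'a
  show "oscale r (x + y) = oscale r x + oscale r y"
    by (rule oct_exhaust[of x], rule oct_exhaust[of y])
      (simp add: oscale_def distrib_left)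
  show "oscale (r + s) x = oscale r x + oscale s x"
    by (rule oct_exhaust[of x]) (simp add: oscale_def distrib_right)
  show "oscale r (oscale s x) = oscale (r * s) x"
    by (rule oct_exhaust[of x]) (simp add: oscale_def)
  show "oscale 1 x = x"
    by (rule oct_exhaust[of x]) (simp add: oscale_def)
  show "(2::'a) \<noteq> 0"
    by (rule two_nonzero)
  show "omul lam mu nu (x + y) z = omul lam mu nu x z + omul lam mu nu y z"
    by (rule oct_exhaust[of x], rule oct_exhaust[of y], rule oct_exhaust[of z])
      (simp add: omul_def algebra_simps)
  show "omul lam mu nu z (x + y) = omul lam mu nu z x + omul lam mu nu z y"
    by (rule oct_exhaust[of x], rule oct_exhaust[of y], rule oct_exhaust[of z])
      (simp add: omul_def algebra_simps)
  show "omul lam mu nu (oscale r x) z = oscale r (omul lam mu nu x z)"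
    by (rule oct_exhaust[of x], rule oct_exhaust[of z])
      (simp add: omul_def oscale_def algebra_simps)
  show "omul lam mu nu z (oscale r x) = oscale r (omul lam mu nu z x)"
    by (rule oct_exhaust[of x], rule oct_exhaust[of z])
      (simp add: omul_def oscale_def algebra_simps)
  show "omul lam mu nu oone x = x" "omul lam mu nu x oone = x"
    by (rule oct_exhaust[of x], simp add: omul_def oone_def qone_def qzero_def)+
  show "oip lam mu nu x y = oip lam mu nu y x"
    by (simp add: oip_def qip_commute)
  show "oip lam mu nu (x + y) z = oip lam mu nu x z + oip lam mu nu y z"
    by (simp add: oip_def plus_quat_def qip_qadd_left algebra_simps)
  show "oip lam mu nu (oscale r x) z = r * oip lam mu nu x z"
    by (simp add: oip_def oscale_def qip_qscale_left algebra_simps)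
  show "oip lam mu nu oone oone = 2"
    by (simp add: oip_def oone_def qone_def qzero_def)
  show "2 * oip lam mu nu (omul lam mu nu x y) (omul lam mu nu x y) =
      oip lam mu nu x x * oip lam mu nu y y"
    by (rule oip_composition)
  show "x = 0" if "\<And>z. oip lam mu nu x z = 0"
  proof (rule oct_exhaust[of x])
    fix a0 a1 a2 a3 b0 b1 b2 b3
    assume x: "x = (Quat a0 a1 a2 a3, Quat b0 b1 b2 b3)"
    \<comment> \<open>Pairing with the eight units isolates each coordinate, up to sign times a
      nonzero product of 2 and the parameters.\<close>
    show ?thesis
      using that[of "(Quat 1 0 0 0, 0)"] that[of "(Quat 0 1 0 0, 0)"]
        that[of "(Quat 0 0 1 0, 0)"] that[of "(Quat 0 0 0 1, 0)"]
        that[of "(0, Quat 1 0 0 0)"] that[of "(0, Quat 0 1 0 0)"]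
        that[of "(0, Quat 0 0 1 0)"] that[of "(0, Quat 0 0 0 1)"] two_nonzero lam mu nu
      by (simp add: x oip_def zero_Quat zero_prod_def)
  qed
qed

interpretation O: composition_algebra oscale "omul lam mu nu" oone "oip lam mu nu"
  by (rule oct_composition_algebra)

lemma cj_eq_oconj: "O.cj x = oconj x"
  by (rule oct_exhaust[of x])
    (unfold O.cj_def, simp add: oconj_def oip_def oone_def oscale_def qone_def qzero_def)

lemma herm_jordan_form: "jordan_form O.hscale O.hmul O.hone O.hform (O.hbasis oct_basis)"
proof (rule O.jordan_form_herm)
  show "finite (oct_basis :: 'a oct set)"
    by (simp add: oct_basis_def quat_basis_def)
  have "x \<in> O.span oct_basis" for x :: "'a oct"
  proof (rule oct_exhaust[of x])
    fix a0 a1 a2 a3 b0 b1 b2 b3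
    assume "x = (Quat a0 a1 a2 a3, Quat b0 b1 b2 b3)"
    then have "x = oscale a0 (Quat 1 0 0 0, 0) + oscale a1 (Quat 0 1 0 0, 0)
        + oscale a2 (Quat 0 0 1 0, 0) + oscale a3 (Quat 0 0 0 1, 0)
        + oscale b0 (0, Quat 1 0 0 0) + oscale b1 (0, Quat 0 1 0 0)
        + oscale b2 (0, Quat 0 0 1 0) + oscale b3 (0, Quat 0 0 0 1)"
      by (simp add: oscale_def zero_Quat)
    also have "\<dots> \<in> O.span oct_basis"
      by (intro O.span_add O.span_scale O.span_base) (simp_all add: oct_basis_def quat_basis_def)
    finally show ?thesis .
  qed
  then show "O.span oct_basis = UNIV"
    by blast
  show "oip lam mu nu x y = 0" if "x \<in> oct_basis" "y \<in> oct_basis" "x \<noteq> y" for x y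
    using that by (auto simp: oct_basis_def quat_basis_def oip_def zero_Quat)
  show "oip lam mu nu x x \<noteq> 0" if "x \<in> oct_basis" for x
    using that two_nonzero lam mu nu
    by (auto simp: oct_basis_def quat_basis_def oip_def zero_Quat)
qed

interpretation J: jordan_form O.hscale O.hmul O.hone O.hform "O.hbasis oct_basis"
  by (rule herm_jordan_form)


section \<open>Transport of the Jordan structure to matrices\<close>

lemma oconj_add: "oconj (x + y) = oconj x + oconj (y :: 'a oct)"
  using O.cj_add by (simp add: cj_eq_oconj)

lemma oconj_scale: "oconj (oscale k x) = oscale k (oconj (x :: 'a oct))"
  using O.cj_scale by (simp add: cj_eq_oconj)

lemma oconj_mul: "oconj (omul lam mu nu x y) = omul lam mu nu (oconj y) (oconj x)"
  using O.cj_mul by (simp add: cj_eq_oconj)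

lemma herm_matrix_exists:
  assumes "(x :: 'a mat3) \<in> H3"
  obtains h where "x = herm_matrix h"
proof -
  \<comment> \<open>A diagonal entry equals its own conjugate, so it is a scalar because 2 is
    nonzero.\<close>
  have diag: "\<exists>k. x i i = oscale k oone" if "i < 3" for i
  proof (rule oct_exhaust[of "x i i"])
    fix a0 a1 a2 a3 b0 b1 b2 b3
    assume *: "x i i = (Quat a0 a1 a2 a3, Quat b0 b1 b2 b3)"
    have "x i i = oconj (x i i)"
      using assms that unfolding H3_def by blast
    then have "x i i = oscale a0 oone"
      unfolding * by (simp add: oconj_def oscale_def oone_def qone_def qzero_def two_nonzero)
    then show ?thesis ..
  qed
  obtain r where "x 0 0 = oscale r oone"
    using diag[of 0] by auto
  moreover obtain s where "x (Suc 0) (Suc 0) = oscale s oone"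
    using diag[of "Suc 0"] by auto
  moreover obtain t where "x 2 2 = oscale t oone"
    using diag[of 2] by auto
  moreover have "x 2 (Suc 0) = oconj (x (Suc 0) 2)" "x 0 2 = oconj (x 2 0)" "x (Suc 0) 0 = oconj (x 0 (Suc 0))"
    using assms unfolding H3_def less_3_cases by blast+
  moreover have "x i j = 0" if "i \<ge> 3 \<or> j \<ge> 3" for i j
    using assms that unfolding H3_def ozero_eq by blast
  ultimately have "x = herm_matrix (r, s, t, x (Suc 0) 2, x 2 0, x 0 (Suc 0))"
    by (intro mat3_eqI) (simp_all add: herm_matrix_outside)
  then show thesis
    by (rule that)
qed

lemma inj_herm_matrix: "inj (herm_matrix :: ('a, 'a oct) herm \<Rightarrow> 'a mat3)"
proof (rule injI)
  fix h h' :: "('a, 'a oct) herm"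
  assume eq: "herm_matrix h = herm_matrix h'"
  obtain r s t a b c where h: "h = (r, s, t, a, b, c)"
    by (rule prod_cases6)
  obtain r' s' t' a' b' c' where h': "h' = (r', s', t', a', b', c')"
    by (rule prod_cases6)
  have "herm_matrix h i j = herm_matrix h' i j" for i j
    by (simp add: eq)
  from this[of 0 0] this[of "Suc 0" "Suc 0"] this[of 2 2] this[of "Suc 0" 2] this[of 2 0] this[of 0 "Suc 0"]
  show "h = h'"
    by (simp add: h h' oscale_def oone_def qone_def)
qed

lemma herm_matrix_add: "herm_matrix (g + h :: ('a, 'a oct) herm) = madd (herm_matrix g) (herm_matrix h)"
proof -
  obtain r s t a b c where g: "g = (r, s, t, a, b, c)"
    by (rule prod_cases6)
  obtain r' s' t' a' b' c' where h: "h = (r', s', t', a', b', c')"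
    by (rule prod_cases6)
  show ?thesis
    by (rule mat3_eqI)
      (simp_all add: g h madd_def oadd_eq herm_matrix_outside O.scale_left_distrib oconj_add)
qed

lemma herm_matrix_scale: "herm_matrix (O.hscale k h) = mscale k (herm_matrix h)"
proof -
  obtain r s t a b c where h: "h = (r, s, t, a, b, c)"
    by (rule prod_cases6)
  show ?thesis
    by (rule mat3_eqI) (simp_all add: h mscale_def herm_matrix_outside oconj_scale)
qed

lemma herm_matrix_one: "herm_matrix O.hone = mone"
  by (rule mat3_eqI) (auto simp: O.hone_def mone_def herm_matrix_outside ozero_eq simp flip: cj_eq_oconj)

text \<open>The linearized alternative laws evaluated at \<open>oone\<close>. They turn the products
  in the diagonal entries of xy + yx into values of the form.\<close>

lemma omul_oconj:
  "omul lam mu nu x (oconj y) + omul lam mu nu y (oconj x) = oscale (oip lam mu nu x y) oone"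
  "omul lam mu nu (oconj x) y + omul lam mu nu (oconj y) x = oscale (oip lam mu nu x y) oone"
  using O.left_alternative_linearized[of x y oone] O.right_alternative_linearized[of oone x y]
  by (simp_all add: cj_eq_oconj O.ip_commute add.commute)

lemma herm_matrix_brace:
  "herm_matrix (O.brace g h) =
    madd (mmul lam mu nu (herm_matrix g) (herm_matrix h)) (mmul lam mu nu (herm_matrix h) (herm_matrix g))"
proof -
  obtain r s t a b c where g: "g = (r, s, t, a, b, c)"
    by (rule prod_cases6)
  obtain r' s' t' a' b' c' where h: "h = (r', s', t', a', b', c')"
    by (rule prod_cases6)
  \<comment> \<open>The coefficient 2 is split into the contributions of the two matrix
    products.\<close>
  have two: "oscale (2 * u * v) oone = oscale (u * v) oone + oscale (v * u) oone" for u v :: 'a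
    by (simp add: mult.commute flip: O.scale_left_distrib)
  note entries = g h madd_def mmul_def oadd_eq O.mul_scale_left O.mul_scale_right two
    oconj_add oconj_scale oconj_mul oconj_oconj O.scale_left_distrib add_ac cj_eq_oconj
  let ?M = "madd (mmul lam mu nu (herm_matrix g) (herm_matrix h)) (mmul lam mu nu (herm_matrix h) (herm_matrix g))"
  have "?M 0 0 = herm_matrix (O.brace g h) 0 0"
    by (simp add: entries omul_oconj(1)[of c, symmetric] omul_oconj(2)[of b, symmetric])
  moreover have "?M (Suc 0) (Suc 0) = herm_matrix (O.brace g h) (Suc 0) (Suc 0)"
    by (simp add: entries omul_oconj(1)[of a, symmetric] omul_oconj(2)[of c, symmetric])
  moreover have "?M 2 2 = herm_matrix (O.brace g h) 2 2"
    by (simp add: entries omul_oconj(1)[of b, symmetric] omul_oconj(2)[of a, symmetric])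
  moreover have "?M i j = 0" if "i \<ge> 3 \<or> j \<ge> 3" for i j
    using that by (elim disjE) (simp_all add: madd_def mmul_def oadd_eq herm_matrix_outside)
  ultimately show ?thesis
    by (intro mat3_eqI) (simp_all add: herm_matrix_outside, simp_all add: entries)
qed

lemma herm_matrix_mul: "herm_matrix (O.hmul g h) = jprod lam mu nu (herm_matrix g) (herm_matrix h)"
  by (simp add: O.hmul_def herm_matrix_scale herm_matrix_brace jprod_def)

lemma herm_matrix_U: "herm_matrix (J.U g h) = Uop lam mu nu (herm_matrix g) (herm_matrix h)"
proof -
  have "J.U g h = O.hscale 2 (O.hmul g (O.hmul g h)) + O.hscale (-1) h"
    by (simp add: J.U_def)
  then show ?thesis
    by (simp only: Uop_def herm_matrix_add herm_matrix_scale herm_matrix_mul)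
qed

lemma jordan_automorphism_if_two_local:
  assumes "two_local_1_automorphism lam mu nu D"
  shows "jordan_automorphism lam mu nu D"
proof -
  \<comment> \<open>\<open>D\<close> read in coordinates. As \<open>inv herm_matrix\<close> is
    meaningful only on the range, \<open>D\<close> must first be shown to map \<open>H3\<close> into
    itself.\<close>
  define E where "E h = inv herm_matrix (D (herm_matrix h))" for h
  have D_H3: "D x \<in> H3" if "x \<in> H3" for x
  proof -
    obtain s where s: "is_symmetry lam mu nu s" "D x = Uop lam mu nu s x"
      using assms \<open>x \<in> H3\<close> unfolding two_local_1_automorphism_def by blast
    obtain g h where "s = herm_matrix g" "x = herm_matrix h"
      using s(1) \<open>x \<in> H3\<close> herm_matrix_exists unfolding is_symmetry_def by metis
    with s(2) show ?thesis
      by (metis herm_matrix_U herm_matrix_H3)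
  qed
  have D_E: "D (herm_matrix h) = herm_matrix (E h)" for h
    using herm_matrix_exists[OF D_H3[OF herm_matrix_H3]]
    by (metis E_def f_inv_into_f rangeI)
  \<comment> \<open>Symmetries correspond under \<open>herm_matrix\<close>, since it is injective
    and respects product, unit and \<open>U\<close>; so locality holds in coordinates.\<close>
  have "\<exists>s. O.hmul s s = O.hone \<and> E x = J.U s x \<and> E y = J.U s y" for x y
  proof -
    obtain s where s: "is_symmetry lam mu nu s" "D (herm_matrix x) = Uop lam mu nu s (herm_matrix x)"
        "D (herm_matrix y) = Uop lam mu nu s (herm_matrix y)"
      using assms herm_matrix_H3 unfolding two_local_1_automorphism_def by blast
    moreover obtain g where "s = herm_matrix g"
      using s(1) herm_matrix_exists unfolding is_symmetry_def by blast
    ultimately show ?thesis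
      by (intro exI[of _ g])
        (simp add: is_symmetry_def D_E inj_herm_matrix[THEN inj_eq]
          flip: herm_matrix_U herm_matrix_mul herm_matrix_one)
  qed
  note E = J.two_local_automorphism[OF this]
  have bij: "bij_betw herm_matrix UNIV (H3 :: 'a mat3 set)"
    unfolding bij_betw_def
  proof (intro conjI equalityI subsetI)
    show "inj (herm_matrix :: ('a, 'a oct) herm \<Rightarrow> 'a mat3)"
      by (rule inj_herm_matrix)
    show "x \<in> H3" if "x \<in> range herm_matrix" for x :: "'a mat3"
      using that herm_matrix_H3 by blast
    show "x \<in> range herm_matrix" if "x \<in> H3" for x :: "'a mat3"
      using herm_matrix_exists[OF that] by blast
  qed
  have "bij_betw (herm_matrix \<circ> E \<circ> inv herm_matrix) H3 H3"
    by (intro bij_betw_trans[OF bij_betw_inv_into[OF bij]] bij_betw_trans[OF E(1) bij] )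
  then have "bij_betw D H3 H3"
  proof (rule bij_betw_cong[THEN iffD1, rotated])
    fix x :: "'a mat3"
    assume "x \<in> H3"
    then obtain h where "x = herm_matrix h"
      by (rule herm_matrix_exists)
    then show "(herm_matrix \<circ> E \<circ> inv herm_matrix) x = D x"
      by (simp add: inv_f_f[OF inj_herm_matrix] D_E)
  qed
  moreover have "D (madd x y) = madd (D x) (D y)" "D (mscale k x) = mscale k (D x)"
    "D (jprod lam mu nu x y) = jprod lam mu nu (D x) (D y)" if "x \<in> H3" "y \<in> H3" for x y k
  proof -
    obtain g h where "x = herm_matrix g" "y = herm_matrix h"
      using \<open>x \<in> H3\<close> \<open>y \<in> H3\<close> herm_matrix_exists by metis
    then show "D (madd x y) = madd (D x) (D y)" "D (mscale k x) = mscale k (D x)"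
      "D (jprod lam mu nu x y) = jprod lam mu nu (D x) (D y)"
      by (simp_all add: D_E E flip: herm_matrix_add herm_matrix_scale herm_matrix_mul)
  qed
  ultimately show ?thesis
    unfolding jordan_automorphism_def by blast
qed

end

theorem theorem4p8:
  fixes lam mu nu :: "'a::field"
    and D :: "'a mat3 \<Rightarrow> 'a mat3"
  assumes "alg_closed_field TYPE('a)"
    and "(2::'a) \<noteq> 0"
    and "lam \<noteq> 0" and "mu \<noteq> 0" and "nu \<noteq> 0"
    and "two_local_1_automorphism lam mu nu D"
  shows "jordan_automorphism lam mu nu D"
  using jordan_automorphism_if_two_local assms(2-6) .

end
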